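(* For every finite simple graph $G$, the following statements are equivalent: (1) $G$ is domishold; (2) the dominating set hypergraph $\mathcal{D}(G)$ is threshold; (3) the dominating set hypergraph $\mathcal{D}(G)$ is $2$-asummable.
   Context: A hypergraph $\mathcal{H}=(V,E)$ consists of a finite vertex set $V$ and a set $E$ of subsets of $V$ (hyperedges). A set $X\subseteq V$ is independent in $\mathcal{H}$ if it contains no hyperedge, and dependent otherwise. $\mathcal{H}$ is threshold if there exist $w:V\to\mathbb{Z}_{\ge0}$ and $t\in\mathbb{Z}_{\ge0}$ such that for every $X\subseteq V$, $\sum_{x\in X}w(x)\ge t$ if and only if $X$ contains some hyperedge. $\mathcal{H}$ is $2$-asummable if there are no (not necessarily distinct) independent sets $A_1,A_2$ and dependent sets $B_1,B_2$ with $\chi^{A_1}+\chi^{A_2}=\chi^{B_1}+\chi^{B_2}$, where $\chi^S$ is the characteristic vector of $S$. A dominating set of a graph $G$ is a set $D\subseteq V(G)$ such that every vertex is in $D$ or has a neighbor in $D$. $G=(V,E)$ is domishold if there exist $w:V\to\mathbb{Z}_{\ge0}$ and $t\in\mathbb{Z}_{\ge0}$ such that for every $X\subseteq V$, $\sum_{x\in X}w(x)\ge t$ if and only if $X$ is a dominating set. The dominating set hypergraph $\mathcal{D}(G)$ has vertex set $V(G)$ and as hyperedges exactly the inclusion-minimal dominating sets of $G$. *)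

theory Defs
  imports "Graph_Theory.Pair_Digraph" "HOL-Library.Indicator_Function"
begin

text \<open>
  A finite simple graph is a \<open>pair_graph\<close>: a finite vertex set \<open>pverts G\<close> with a finite, symmetric,
  irreflexive adjacency relation \<open>parcs G\<close> on it. The null graph is allowed.
\<close>

section \<open>Hypergraphs\<close>

record 'a hypergraph =
  hverts :: "'a set"
  hedges :: "'a set set"

definition hypergraph :: "'a hypergraph \<Rightarrow> bool" where
  "hypergraph H \<longleftrightarrow> finite (hverts H) \<and> hedges H \<subseteq> Pow (hverts H)"

definition dependent_set :: "'a hypergraph \<Rightarrow> 'a set \<Rightarrow> bool" where
  "dependent_set H X \<longleftrightarrow> X \<subseteq> hverts H \<and> (\<exists>e\<in>hedges H. e \<subseteq> X)"

definition independent_set :: "'a hypergraph \<Rightarrow> 'a set \<Rightarrow> bool" where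
  "independent_set H X \<longleftrightarrow> X \<subseteq> hverts H \<and> \<not> (\<exists>e\<in>hedges H. e \<subseteq> X)"

definition threshold_hypergraph :: "'a hypergraph \<Rightarrow> bool" where
  "threshold_hypergraph H \<longleftrightarrow>
    (\<exists>(w :: 'a \<Rightarrow> nat) (t :: nat). \<forall>X\<subseteq>hverts H.
      (\<Sum>x\<in>X. w x) \<ge> t \<longleftrightarrow> (\<exists>e\<in>hedges H. e \<subseteq> X))"

text \<open>
  All four sets are subsets of \<open>hverts H\<close>, so comparing the sums of indicators as functions on the
  whole type is the same as comparing them as vectors indexed by \<open>hverts H\<close>.
\<close>
definition two_asummable :: "'a hypergraph \<Rightarrow> bool" where
  "two_asummable H \<longleftrightarrow>
    \<not> (\<exists>A1 A2 B1 B2.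
        independent_set H A1 \<and> independent_set H A2 \<and>
        dependent_set H B1 \<and> dependent_set H B2 \<and>
        (\<lambda>x. indicator A1 x + indicator A2 x :: nat) = (\<lambda>x. indicator B1 x + indicator B2 x))"

section \<open>Domination in graphs\<close>

definition dominating_set :: "'a pair_pre_digraph \<Rightarrow> 'a set \<Rightarrow> bool" where
  "dominating_set G D \<longleftrightarrow>
    D \<subseteq> pverts G \<and> (\<forall>v\<in>pverts G. v \<in> D \<or> (\<exists>u\<in>D. (v, u) \<in> parcs G))"

definition domishold :: "'a pair_pre_digraph \<Rightarrow> bool" where
  "domishold G \<longleftrightarrow>
    (\<exists>(w :: 'a \<Rightarrow> nat) (t :: nat). \<forall>X\<subseteq>pverts G.
      (\<Sum>x\<in>X. w x) \<ge> t \<longleftrightarrow> dominating_set G X)"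

definition dominating_set_hypergraph :: "'a pair_pre_digraph \<Rightarrow> 'a hypergraph" where
  "dominating_set_hypergraph G =
    \<lparr> hverts = pverts G,
      hedges = {D. dominating_set G D \<and> (\<forall>D'. D' \<subset> D \<longrightarrow> \<not> dominating_set G D')} \<rparr>"

lemma hypergraph_dominating_set_hypergraph:
  assumes "pair_graph G"
  shows "hypergraph (dominating_set_hypergraph G)"
proof -
  interpret pair_graph G by fact
  show ?thesis
    using pair_finite_verts
    by (auto simp: hypergraph_def dominating_set_hypergraph_def dominating_set_def)
qed

end

theory Submission
  imports Defs
begin

text \<open>
  The substantial implication is from 2-asummability to the existence of weights. The complement of
  a closed neighbourhood does not dominate, so 2-asummability forbids redistributing the complements
  of \<open>N[a]\<close> and \<open>N[d]\<close> into two dominating sets. This forces the neighbourhoods of any two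
  nonadjacent vertices to be nested, and then that a nonempty graph has an isolated vertex, a
  universal vertex, or two nonadjacent vertices each adjacent to all the others. Removing such a vertex
  or pair preserves 2-asummability, and positive weights for the rest extend to the whole graph.
\<close>

section \<open>Domination and 2-asummability in induced subgraphs\<close>

text \<open>
  A graph is represented by a vertex set together with the reflexive closure \<open>r\<close> of its adjacency
  relation. Induced subgraphs are obtained by changing the vertex set only.
\<close>

locale tolerance =
  fixes r :: "'a \<Rightarrow> 'a \<Rightarrow> bool"
  assumes refl [simp]: "r x x"
    and sym: "r x y \<Longrightarrow> r y x"
begin

definition nbhd :: "'a set \<Rightarrow> 'a \<Rightarrow> 'a set" where
  "nbhd V v = {u \<in> V. r v u}"

definition dom :: "'a set \<Rightarrow> 'a set \<Rightarrow> bool" where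
  "dom V D \<longleftrightarrow> D \<subseteq> V \<and> (\<forall>v\<in>V. \<exists>u\<in>D. r v u)"

text \<open>A sum of two indicators is 2 exactly on the intersection and positive exactly on the
  union, so the two equations encode equality of the characteristic vector sums.\<close>

definition asum :: "'a set \<Rightarrow> bool" where
  "asum V \<longleftrightarrow> (\<forall>A1 A2 B1 B2. A1 \<subseteq> V \<and> A2 \<subseteq> V \<and> dom V B1 \<and> dom V B2 \<and>
     A1 \<inter> A2 = B1 \<inter> B2 \<and> A1 \<union> A2 = B1 \<union> B2 \<longrightarrow> dom V A1 \<or> dom V A2)"

lemma asumD:
  assumes "asum V" "A1 \<subseteq> V" "A2 \<subseteq> V" "dom V B1" "dom V B2"
    "A1 \<inter> A2 = B1 \<inter> B2" "A1 \<union> A2 = B1 \<union> B2"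
  shows "dom V A1 \<or> dom V A2"
  using assms unfolding asum_def by blast

section \<open>Neighbourhoods under 2-asummability\<close>

text \<open>
  If no such \<open>q\<close> existed, moving \<open>S\<close> and \<open>T\<close> between the complements of \<open>N[w]\<close> and \<open>N[w']\<close> would
  turn these two sets into dominating ones.
\<close>

lemma asum_coloring:
  assumes V: "asum V" "w \<in> V" "w' \<in> V"
    and ST: "S \<union> T = (nbhd V w - nbhd V w') \<union> (nbhd V w' - nbhd V w)" "S \<inter> T = {}"
  obtains q where "q \<in> V" "nbhd V q \<subseteq> nbhd V w \<union> nbhd V w'"
    "nbhd V q \<inter> S = {} \<or> nbhd V q \<inter> T = {}"
proof -
  define R where "R = V - (nbhd V w \<union> nbhd V w')"
  have sub: "nbhd V x \<subseteq> V" for x by (auto simp: nbhd_def)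
  have "\<not> dom V (V - nbhd V w)" "\<not> dom V (V - nbhd V w')"
    using V by (auto simp: dom_def nbhd_def)
  moreover have "(V - nbhd V w) \<inter> (V - nbhd V w') = (R \<union> S) \<inter> (R \<union> T)"
    using ST unfolding R_def by blast
  moreover have "(V - nbhd V w) \<union> (V - nbhd V w') = (R \<union> S) \<union> (R \<union> T)"
  proof -
    have "(R \<union> S) \<union> (R \<union> T) = R \<union> (S \<union> T)" by blast
    then show ?thesis unfolding ST(1) using sub[of w] sub[of w'] by (auto simp: R_def)
  qed
  ultimately have "\<not> dom V (R \<union> S) \<or> \<not> dom V (R \<union> T)"
    using asumD[OF V(1), of "V - nbhd V w" "V - nbhd V w'" "R \<union> S" "R \<union> T"] by blast
  moreover have "R \<union> S \<subseteq> V" "R \<union> T \<subseteq> V"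
    using ST(1) sub[of w] sub[of w'] by (auto simp: R_def)
  \<comment> \<open>The closed neighbourhood of an undominated \<open>q\<close> avoids
    \<open>R\<close>, so it lies in the union of the other two.\<close>
  ultimately obtain q where "q \<in> V" "nbhd V q \<inter> (R \<union> S) = {} \<or> nbhd V q \<inter> (R \<union> T) = {}"
    unfolding dom_def nbhd_def by blast
  then show ?thesis
    using that[of q] sub[of q] unfolding R_def by blast
qed

text \<open>Otherwise colour the symmetric difference by side, but exchange \<open>a\<close> and
  \<open>d\<close>. Any \<open>q\<close> whose neighbourhood lies in the union then sees both
  colours, with \<open>b\<close> or \<open>c\<close> supplying the second one if \<open>q\<close> is
  \<open>a\<close> or \<open>d\<close>; this contradicts \<open>asum_coloring\<close>.\<close>

lemma nbhd_nested:
  assumes V: "asum V" "a \<in> V" "d \<in> V" and "\<not> r a d"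
  shows "nbhd V a - {a} \<subseteq> nbhd V d \<or> nbhd V d - {d} \<subseteq> nbhd V a"
proof (rule ccontr)
  assume "\<not> ?thesis"
  then obtain b c where bc: "b \<in> V" "r a b" "b \<noteq> a" "\<not> r d b" "c \<in> V" "r d c" "c \<noteq> d" "\<not> r a c"
    by (auto simp: nbhd_def)
  define X where "X = nbhd V a - nbhd V d"
  define Y where "Y = nbhd V d - nbhd V a"
  have ad: "a \<in> X" "d \<in> Y" "b \<in> X" "c \<in> Y" "a \<noteq> d"
    using assms bc sym[of d a] by (auto simp: X_def Y_def nbhd_def)
  have disj: "X \<inter> Y = {}" by (auto simp: X_def Y_def)
  obtain q where q: "q \<in> V" "nbhd V q \<subseteq> nbhd V a \<union> nbhd V d"
    "nbhd V q \<inter> (insert a (Y - {d})) = {} \<or> nbhd V q \<inter> (insert d (X - {a})) = {}"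
    by (rule asum_coloring[OF V, of "insert a (Y - {d})" "insert d (X - {a})"])
       (use ad disj in \<open>auto simp flip: X_def Y_def\<close>)
  have "q \<in> nbhd V a \<union> nbhd V d" using q(1,2) by (auto simp: nbhd_def)
  then consider "r a q" "r d q" | "q \<in> X" | "q \<in> Y"
    unfolding X_def Y_def nbhd_def by blast
  then show False
  proof cases
    case 1
    then have "a \<in> nbhd V q" "d \<in> nbhd V q" using V sym by (auto simp: nbhd_def)
    with q(3) show False by blast
  next
    case 2
    then have "a \<in> nbhd V q" "q \<in> nbhd V q" "q = a \<Longrightarrow> b \<in> nbhd V q"
      using V sym bc q(1) by (auto simp: nbhd_def X_def)
    with q(3) 2 ad bc show False by blast
  next
    case 3
    then have "d \<in> nbhd V q" "q \<in> nbhd V q" "q = d \<Longrightarrow> c \<in> nbhd V q"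
      using V sym bc q(1) by (auto simp: nbhd_def Y_def)
    with q(3) 3 ad bc show False by blast
  qed
qed

text \<open>If \<open>nbhd_nested\<close> gives the opposite inclusion, the degree bound turns it
  into an equality.\<close>

lemma nbhd_nested_max:
  assumes "asum V" "finite V" "a \<in> V" "d \<in> V" "\<not> r a d" "card (nbhd V d) \<le> card (nbhd V a)"
  shows "nbhd V d - {d} \<subseteq> nbhd V a"
proof (rule ccontr)
  assume neg: "\<not> ?thesis"
  then have "nbhd V a - {a} \<subseteq> nbhd V d - {d}"
    using nbhd_nested[OF assms(1,3-5)] assms(5) by (auto simp: nbhd_def)
  moreover have fin: "finite (nbhd V v)" for v using assms(2) by (simp add: nbhd_def)
  moreover have "card (nbhd V d - {d}) \<le> card (nbhd V a - {a})"
    using assms by (simp add: nbhd_def)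
  ultimately have "nbhd V a - {a} = nbhd V d - {d}"
    by (intro card_seteq) auto
  with neg show False by blast
qed

text \<open>Contrapositive of \<open>nbhd_nested\<close>, with \<open>p\<close> and
  \<open>p'\<close> as private neighbours.\<close>

lemma nested_witness:
  assumes "asum V" "x \<in> V" "y \<in> V" "p \<in> V" "p' \<in> V"
    "r x p" "\<not> r y p" "r y p'" "\<not> r x p'" "p \<noteq> x" "p' \<noteq> y"
  shows "r x y"
  using nbhd_nested[of V x y] assms by (auto simp: nbhd_def)

text \<open>
  Otherwise take \<open>a\<close> of maximal degree, \<open>w\<close> of minimal degree among the nonneighbours of \<open>a\<close>, \<open>b\<close>
  of maximal degree among the neighbours of \<open>w\<close>, and a nonneighbour \<open>w'\<close> of \<open>b\<close>. Then both
  \<open>X = N[w] - N[w']\<close> and \<open>Y = N[w'] - N[w]\<close> have at least two elements and are completely joined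
  to each other, which yields a colouring of \<open>X \<union> Y\<close> that contradicts \<open>asum_coloring\<close>.
\<close>

lemma asum_structure:
  assumes V: "asum V" and fin: "finite V" and ne: "V \<noteq> {}"
  shows "(\<exists>v\<in>V. nbhd V v = {v}) \<or> (\<exists>v\<in>V. nbhd V v = V) \<or>
    (\<exists>x\<in>V. \<exists>y\<in>V. x \<noteq> y \<and> nbhd V x = V - {y} \<and> nbhd V y = V - {x})"
proof (rule ccontr)
  assume neg: "\<not> ?thesis"
  have noniso: "\<exists>u\<in>V. u \<noteq> v \<and> r v u" if "v \<in> V" for v
  proof -
    have "nbhd V v \<noteq> {v}" "v \<in> nbhd V v" using neg that by (auto simp: nbhd_def)
    then show ?thesis by (auto simp: nbhd_def)
  qed
  have nonuniv: "\<exists>u\<in>V. \<not> r v u" if "v \<in> V" for v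
    using neg that by (auto simp: nbhd_def)
  have nonpair: "\<exists>u\<in>V. (u \<noteq> y \<and> \<not> r x u) \<or> (u \<noteq> x \<and> \<not> r y u)"
    if "x \<in> V" "y \<in> V" "\<not> r x y" for x y
  proof (rule ccontr)
    assume "\<not> ?thesis"
    then have "nbhd V x = V - {y}" "nbhd V y = V - {x}"
      using that sym[of y x] by (auto simp: nbhd_def)
    moreover have "x \<noteq> y" using that by auto
    ultimately show False using neg that by blast
  qed
  have max: "\<exists>x\<in>A. \<forall>y\<in>A. f y \<le> f x" if "A \<subseteq> V" "A \<noteq> {}" for A and f :: "'a \<Rightarrow> nat"
  proof -
    have "finite (f ` A)" "f ` A \<noteq> {}" using fin that by (auto intro: finite_subset)
    then show ?thesis using Max_in[of "f ` A"] Max_ge[of "f ` A"] by fastforce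
  qed
  let ?deg = "\<lambda>v. card (nbhd V v)"
  obtain a where a: "a \<in> V" "\<And>v. v \<in> V \<Longrightarrow> ?deg v \<le> ?deg a"
    using max[of V ?deg] ne by blast
  obtain w where w: "w \<in> V" "\<not> r a w" and w_min: "\<And>u. u \<in> V \<Longrightarrow> \<not> r a u \<Longrightarrow> ?deg w \<le> ?deg u"
  proof -
    \<comment> \<open>Maximising \<open>card V - ?deg y\<close> yields the minimal degree.\<close>
    have "\<exists>x\<in>{u\<in>V. \<not> r a u}. \<forall>y\<in>{u\<in>V. \<not> r a u}. card V - ?deg y \<le> card V - ?deg x"
      using nonuniv[OF a(1)] by (intro max) auto
    moreover have "?deg v \<le> card V" for v using fin by (auto simp: nbhd_def intro: card_mono)
    ultimately show ?thesis using that by (smt (verit) diff_le_mono2 diff_diff_cancel mem_Collect_eq)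
  qed
  have "\<exists>x\<in>{u\<in>V. u \<noteq> w \<and> r w u}. \<forall>y\<in>{u\<in>V. u \<noteq> w \<and> r w u}. ?deg y \<le> ?deg x"
    using noniso[OF w(1)] by (intro max) auto
  then obtain b where b: "b \<in> V" "b \<noteq> w" "r w b"
    and b_max: "\<And>u. u \<in> V \<Longrightarrow> u \<noteq> w \<Longrightarrow> r w u \<Longrightarrow> ?deg u \<le> ?deg b"
    by auto
  \<comment> \<open>By maximality of \<open>a\<close>. In particular, the nonneighbours of
    \<open>a\<close> are pairwise nonadjacent.\<close>
  have a_nested: "r a v" if "u \<in> V" "\<not> r a u" "v \<in> V" "r u v" "v \<noteq> u" for u v
    using nbhd_nested_max[OF V fin a(1) that(1,2) a(2)] that by (auto simp: nbhd_def)
  have ab: "r a b" using a_nested[of w b] w b by auto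
  \<comment> \<open>Minimality of \<open>w\<close> puts its neighbours, \<open>b\<close> among them,
    into the neighbourhood of every other nonneighbour of \<open>a\<close>.\<close>
  have b_complete: "r u b" if "u \<in> V" "\<not> r a u" for u
  proof (cases "u = w")
    case False
    then have "\<not> r u w" using a_nested[of u w] that w by auto
    then show ?thesis
      using nbhd_nested_max[OF V fin that(1) w(1) _ w_min[OF that]] b by (auto simp: nbhd_def)
  qed (use b in simp)
  \<comment> \<open>\<open>b\<close> is a private neighbour of \<open>u\<close>, and
    \<open>a\<close> is one of \<open>k\<close>.\<close>
  have cross: "r u k" if "u \<in> V" "\<not> r a u" "k \<in> V" "\<not> r b k" for u k
  proof -
    have "r a k" using b_complete[of k] that sym by blast
    then show ?thesis
      using nested_witness[OF V that(1,3) b(1) a(1)] that a b ab b_complete[of u] sym by metis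
  qed
  \<comment> \<open>By \<open>cross\<close>, \<open>u\<close> is adjacent to \<open>w\<close>, so
    \<open>b_max\<close> bounds its degree.\<close>
  have b_nested: "r b v" if "u \<in> V" "\<not> r b u" "v \<in> V" "r u v" "v \<noteq> u" for u v
  proof -
    have "u \<noteq> w" using that b sym by blast
    then have "?deg u \<le> ?deg b" using b_max cross[OF w] that by blast
    then show ?thesis
      using nbhd_nested_max[OF V fin b(1) that(1,2)] that by (auto simp: nbhd_def)
  qed
  obtain w' where w': "w' \<in> V" "\<not> r b w'" using nonuniv[OF b(1)] by blast
  have ww': "r w w'" "w' \<noteq> w" "r a w'"
    using cross[OF w w'] w' b sym b_complete[of w'] by blast+
  \<comment> \<open>\<open>a\<close> is adjacent to \<open>w'\<close> but not to \<open>w\<close>;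
    \<open>nonpair\<close> for \<open>a\<close> and \<open>w\<close> provides a second such vertex.
    Likewise \<open>x\<close> below joins \<open>b\<close>.\<close>
  obtain y where y: "y \<in> V" "y \<noteq> a" "r w' y" "\<not> r w y"
  proof -
    from nonpair[OF a(1) w] obtain u where u: "u \<in> V" "(u \<noteq> w \<and> \<not> r a u) \<or> (u \<noteq> a \<and> \<not> r w u)"
      by blast
    show ?thesis
    proof (cases "u \<noteq> w \<and> \<not> r a u")
      case True
      then show ?thesis
        using that[of u] u cross[of u w'] w' a_nested[of w u] w sym[of u w'] refl[of a] by blast
    next
      case False
      with u have u': "u \<noteq> a" "\<not> r w u" by auto
      have "r b u" using cross[OF w u(1)] u' by blast
      then have "r w' u"
        using nested_witness[OF V w'(1) u(1) w(1) b(1)] u' ww' w' b sym by metis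
      then show ?thesis using that u u' by blast
    qed
  qed
  obtain x where x: "x \<in> V" "x \<noteq> b" "r w x" "\<not> r w' x"
  proof -
    from nonpair[OF b(1) w'] obtain u where u: "u \<in> V" "(u \<noteq> w' \<and> \<not> r b u) \<or> (u \<noteq> b \<and> \<not> r w' u)"
      by blast
    show ?thesis
    proof (cases "u \<noteq> w' \<and> \<not> r b u")
      case True
      then show ?thesis
        using that[of u] u cross[of w u] w b_nested[of w' u] w' refl[of b] by blast
    next
      case False
      with u have u': "u \<noteq> b" "\<not> r w' u" by auto
      have "r a u" using cross[OF u(1) _ w'] u' sym by blast
      then have "r w u"
        using nested_witness[OF V w(1) u(1) w'(1) a(1)] u' ww' w a sym by metis
      then show ?thesis using that u u' by blast
    qed
  qed
  define X where "X = nbhd V w - nbhd V w'"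
  define Y where "Y = nbhd V w' - nbhd V w"
  have mem: "a \<in> Y" "y \<in> Y" "b \<in> X" "x \<in> X" and disj: "X \<inter> Y = {}"
    using a b w w' x y ww' sym by (auto simp: X_def Y_def nbhd_def)
  have XY: "r p q" if "p \<in> X" "q \<in> Y" for p q
    using nested_witness[OF V, of p q w w'] that w w' ww' sym
    unfolding X_def Y_def nbhd_def by blast
  \<comment> \<open>Exchanging \<open>x\<close> and \<open>y\<close> gives both \<open>X\<close> and
    \<open>Y\<close> both colours: \<open>x\<close>, \<open>a\<close> have one and \<open>y\<close>,
    \<open>b\<close> the other. In the three cases below \<open>q\<close> sees all of
    \<open>X\<close>, all of \<open>Y\<close>, or both \<open>a\<close> and
    \<open>b\<close>.\<close>
  obtain q where q: "q \<in> V" "nbhd V q \<subseteq> nbhd V w \<union> nbhd V w'"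
    "nbhd V q \<inter> (insert x (Y - {y})) = {} \<or> nbhd V q \<inter> (insert y (X - {x})) = {}"
    by (rule asum_coloring[OF V w(1) w'(1), of "insert x (Y - {y})" "insert y (X - {x})"])
       (use mem disj in \<open>auto simp flip: X_def Y_def\<close>)
  have "q \<in> nbhd V w \<union> nbhd V w'" using q(1,2) by (auto simp: nbhd_def)
  then consider "q \<in> Y \<or> q = w" | "q \<in> X \<or> q = w'" | "r w q" "r w' q" "q \<noteq> w" "q \<noteq> w'"
    unfolding X_def Y_def nbhd_def by blast
  then show False
  proof cases
    case 1
    have "X \<subseteq> V" "\<And>p. p \<in> X \<Longrightarrow> r w p" by (auto simp: X_def nbhd_def)
    then have "X \<subseteq> nbhd V q" using XY sym 1 unfolding nbhd_def by blast
    with q(3) mem x show False by blast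
  next
    case 2
    have "Y \<subseteq> V" "\<And>p. p \<in> Y \<Longrightarrow> r w' p" by (auto simp: Y_def nbhd_def)
    then have "Y \<subseteq> nbhd V q" using XY 2 unfolding nbhd_def by blast
    with q(3) mem y show False by blast
  next
    case 3
    then have "r a q" "r b q" using a_nested[OF w q(1)] b_nested[OF w' q(1)] by auto
    then have "a \<in> nbhd V q" "b \<in> nbhd V q" using a b sym by (auto simp: nbhd_def)
    with q(3) mem x y show False by blast
  qed
qed

section \<open>Removing vertices\<close>

lemma dom_isolated:
  assumes "v \<in> V" "nbhd V v = {v}" "D \<subseteq> V"
  shows "dom V D \<longleftrightarrow> v \<in> D \<and> dom (V - {v}) (D - {v})"
proof -
  have iso: "\<not> r v u" "\<not> r u v" if "u \<in> V" "u \<noteq> v" for u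
    using assms(2) that sym by (auto simp: nbhd_def)
  show ?thesis
  proof
    assume D: "dom V D"
    then have "v \<in> D" using assms iso unfolding dom_def by (metis subsetD)
    moreover have "\<exists>u\<in>D - {v}. r z u" if "z \<in> V - {v}" for z
      using D that iso unfolding dom_def by (metis DiffD1 DiffD2 DiffI singleton_iff)
    ultimately show "v \<in> D \<and> dom (V - {v}) (D - {v})"
      using assms(3) by (auto simp: dom_def)
  next
    assume D: "v \<in> D \<and> dom (V - {v}) (D - {v})"
    then show "dom V D" using assms(3) refl unfolding dom_def by blast
  qed
qed

text \<open>Any element of \<open>D\<close> dominates all of \<open>U\<close>, and a dominating set
  of the nonempty \<open>V - U\<close> has an element.\<close>

lemma dom_joined:
  assumes "\<And>u z. u \<in> U \<Longrightarrow> z \<in> V - U \<Longrightarrow> r u z" "V - U \<noteq> {}" "D \<subseteq> V - U"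
  shows "dom V D \<longleftrightarrow> dom (V - U) D"
proof
  assume D: "dom (V - U) D"
  then obtain d where "d \<in> D" using assms(2) by (auto simp: dom_def)
  then show "dom V D" using D assms(1)[of _ d] assms(3) unfolding dom_def by blast
qed (use assms(3) in \<open>auto simp: dom_def\<close>)

text \<open>Adding \<open>v\<close> to all four sets turns a violation for \<open>V - {v}\<close>
  into one for \<open>V\<close>.\<close>

lemma asum_isolated:
  assumes "asum V" "v \<in> V" "nbhd V v = {v}"
  shows "asum (V - {v})"
  unfolding asum_def
proof (intro allI impI, elim conjE)
  fix A1 A2 B1 B2
  assume A: "A1 \<subseteq> V - {v}" "A2 \<subseteq> V - {v}" and B: "dom (V - {v}) B1" "dom (V - {v}) B2"
    and eq: "A1 \<inter> A2 = B1 \<inter> B2" "A1 \<union> A2 = B1 \<union> B2"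
  have ins: "dom V (insert v D) \<longleftrightarrow> dom (V - {v}) D" if "D \<subseteq> V - {v}" for D
    using dom_isolated[OF assms(2,3), of "insert v D"] that assms(2)
    by (metis Diff_insert_absorb Diff_subset insertI1 insert_subset order_trans subset_Diff_insert)
  have "B1 \<subseteq> V - {v}" "B2 \<subseteq> V - {v}" using B by (auto simp: dom_def)
  then show "dom (V - {v}) A1 \<or> dom (V - {v}) A2"
    using asumD[OF assms(1), of "insert v A1" "insert v A2" "insert v B1" "insert v B2"]
      A B eq ins assms(2) by auto
qed

lemma asum_joined:
  assumes "asum V" "\<And>u z. u \<in> U \<Longrightarrow> z \<in> V - U \<Longrightarrow> r u z" "V - U \<noteq> {}"
  shows "asum (V - U)"
  unfolding asum_def
proof (intro allI impI, elim conjE)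
  fix A1 A2 B1 B2
  assume A: "A1 \<subseteq> V - U" "A2 \<subseteq> V - U" and B: "dom (V - U) B1" "dom (V - U) B2"
    and eq: "A1 \<inter> A2 = B1 \<inter> B2" "A1 \<union> A2 = B1 \<union> B2"
  have "B1 \<subseteq> V - U" "B2 \<subseteq> V - U" using B by (auto simp: dom_def)
  then show "dom (V - U) A1 \<or> dom (V - U) A2"
    using asumD[OF assms(1), of A1 A2 B1 B2] A B eq dom_joined[OF assms(2,3)] by auto
qed

section \<open>Extending weights\<close>

text \<open>
  Positivity of the weights is needed to extend them to a pair of nonadjacent vertices adjacent to
  all others: one vertex of the pair has weight just below the threshold.
\<close>

definition separates :: "('a \<Rightarrow> nat) \<Rightarrow> nat \<Rightarrow> 'a set \<Rightarrow> bool" where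
  "separates w t V \<longleftrightarrow> (\<forall>x. 0 < w x) \<and> (\<forall>X\<subseteq>V. t \<le> sum w X \<longleftrightarrow> dom V X)"

text \<open>Sets without \<open>v\<close> weigh at most \<open>sum w V\<close> and miss the new
  threshold; once \<open>v\<close> is present, exactly \<open>t\<close> remains for the
  rest.\<close>

lemma separates_isolated:
  assumes fin: "finite V" and v: "v \<in> V" "nbhd V v = {v}" and w: "separates w t (V - {v})"
  shows "separates (w(v := Suc (sum w V))) (t + Suc (sum w V)) V"
  unfolding separates_def
proof (intro conjI allI impI)
  fix X assume X: "X \<subseteq> V"
  let ?w = "w(v := Suc (sum w V))"
  have finX: "finite X" using X fin finite_subset by blast
  have eq: "sum ?w (X - {v}) = sum w (X - {v})" by (intro sum.cong) auto
  have iff: "t \<le> sum w (X - {v}) \<longleftrightarrow> dom (V - {v}) (X - {v})"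
    using w X unfolding separates_def by (simp add: Diff_mono)
  show "t + Suc (sum w V) \<le> sum ?w X \<longleftrightarrow> dom V X"
  proof (cases "v \<in> X")
    case True
    then show ?thesis
      using dom_isolated[OF v X] iff eq sum.remove[OF finX True, of ?w] by simp
  next
    case False
    then have "sum ?w X = sum w X" by (intro sum.cong) auto
    moreover have "sum w X \<le> sum w V" using X fin by (intro sum_mono2) auto
    ultimately show ?thesis using dom_isolated[OF v X] False by auto
  qed
qed (use w in \<open>auto simp: separates_def\<close>)

lemma separates_pos:
  assumes "separates w t V" "V \<noteq> {}"
  shows "0 < t"
  using assms by (force simp: separates_def dom_def)

text \<open>\<open>v\<close> dominates alone, so it receives the whole threshold, which is positive
  by \<open>separates_pos\<close>.\<close>

lemma separates_universal:
  assumes fin: "finite V" and v: "v \<in> V" "nbhd V v = V" and ne: "V - {v} \<noteq> {}"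
    and w: "separates w t (V - {v})"
  shows "separates (w(v := t)) t V"
  unfolding separates_def
proof (intro conjI allI impI)
  fix X assume X: "X \<subseteq> V"
  let ?w = "w(v := t)"
  have finX: "finite X" using X fin finite_subset by blast
  have adj: "r v z" "r z v" if "z \<in> V" for z using v that sym by (auto simp: nbhd_def)
  show "t \<le> sum ?w X \<longleftrightarrow> dom V X"
  proof (cases "v \<in> X")
    case True
    then have "dom V X" using X adj by (auto simp: dom_def)
    moreover have "t \<le> sum ?w X" using sum.remove[OF finX True, of ?w] by simp
    ultimately show ?thesis by simp
  next
    case False
    then have "sum ?w X = sum w X" by (intro sum.cong) auto
    moreover have "dom V X \<longleftrightarrow> dom (V - {v}) X"
      using False X adj ne by (intro dom_joined) auto
    moreover have "X \<subseteq> V - {v}" using False X by blast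
    ultimately show ?thesis using w by (simp add: separates_def)
  qed
qed (use separates_pos[OF w ne] w in \<open>auto simp: separates_def\<close>)

text \<open>\<open>x\<close> and \<open>y\<close> do not dominate alone, but each does with any
  further vertex: \<open>2 * t - 1\<close> is one short of the threshold, and any positive weight
  closes the gap. Doubling keeps this weight positive even for \<open>t = 1\<close>.\<close>

lemma separates_antipodal:
  assumes fin: "finite V" and xy: "x \<in> V" "y \<in> V" "x \<noteq> y" "nbhd V x = V - {y}" "nbhd V y = V - {x}"
    and ne: "V - {x, y} \<noteq> {}" and w: "separates w t (V - {x, y})"
  shows "separates (\<lambda>z. if z \<in> {x, y} then 2 * t - 1 else 2 * w z) (2 * t) V"
    (is "separates ?w _ _")
  unfolding separates_def
proof (intro conjI allI impI)
  have t: "0 < t" by (rule separates_pos[OF w ne])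
  have wpos: "0 < w z" for z using w by (simp add: separates_def)
  show pos: "0 < ?w z" for z using t wpos by auto
  fix X assume X: "X \<subseteq> V"
  have finX: "finite X" using X fin finite_subset by blast
  have adj: "r x z" "r z x" if "z \<in> V" "z \<noteq> y" for z
    using xy that sym by (auto simp: nbhd_def)
  have adj': "r y z" "r z y" if "z \<in> V" "z \<noteq> x" for z
    using xy that sym by (auto simp: nbhd_def)
  have nadj: "\<not> r x y" "\<not> r y x" using xy sym by (auto simp: nbhd_def)
  show "2 * t \<le> sum ?w X \<longleftrightarrow> dom V X"
  proof (cases "x \<in> X \<or> y \<in> X")
    case True
    then obtain p q where pq: "p \<in> X" "{p, q} = {x, y}" "p \<noteq> q" using xy by auto
    show ?thesis
    proof (cases "X = {p}")
      case True
      have "\<not> dom V X" using True pq nadj xy by (auto simp: dom_def doubleton_eq_iff)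
      moreover have "sum ?w X = 2 * t - 1" using True pq by auto
      ultimately show ?thesis using t by simp
    next
      case False
      then obtain z where z: "z \<in> X" "z \<noteq> p" using pq by blast
      \<comment> \<open>\<open>p\<close> dominates everything but \<open>q\<close>, and
        \<open>z\<close> dominates \<open>q\<close>, whose only nonneighbour is
        \<open>p\<close>.\<close>
      have "\<exists>u\<in>X. r v u" if "v \<in> V" for v
      proof (cases "v = q")
        case True
        have "r q z" using pq z X adj adj' nadj refl[of q] by (auto simp: doubleton_eq_iff)
        then show ?thesis using z True by blast
      next
        case False
        then have "r v p" using pq adj adj' that by (auto simp: doubleton_eq_iff)
        then show ?thesis using pq by blast
      qed
      then have "dom V X" using X by (auto simp: dom_def)
      moreover have "?w p + ?w z \<le> sum ?w X"
        using sum_mono2[OF finX, of "{p, z}" ?w] pq z by simp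
      moreover have "?w p = 2 * t - 1" using pq by auto
      ultimately show ?thesis using t pos[of z] by linarith
    qed
  next
    case False
    then have "sum ?w X = sum (\<lambda>z. 2 * w z) X" by (intro sum.cong) auto
    then have "sum ?w X = 2 * sum w X" by (simp add: sum_distrib_left)
    moreover have "dom V X \<longleftrightarrow> dom (V - {x, y}) X"
      using False X adj adj' ne by (intro dom_joined) auto
    moreover have "X \<subseteq> V - {x, y}" using False X by blast
    ultimately show ?thesis using w by (simp add: separates_def)
  qed
qed

lemma asum_separates:
  assumes "finite V" "asum V"
  shows "\<exists>w t. separates w t V"
  using assms
proof (induction V rule: finite_psubset_induct)
  case (psubset V)
  show ?case
  proof (cases "V = {}")
    case True
    then have "separates (\<lambda>_. 1) 0 V" by (auto simp: separates_def dom_def)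
    then show ?thesis by blast
  next
    case False
    have IH: "\<exists>w t. separates w t (V - U)" if "U \<subseteq> V" "U \<noteq> {}" "asum (V - U)" for U
      using psubset.IH[of "V - U"] that by blast
    show ?thesis
    proof (cases "\<exists>v\<in>V. nbhd V v = {v}")
      case True
      then obtain v where v: "v \<in> V" "nbhd V v = {v}" by blast
      then show ?thesis
        using IH[of "{v}"] asum_isolated[OF psubset.prems v] separates_isolated[OF psubset.hyps v]
        by blast
    next
      \<comment> \<open>Without isolated vertices, \<open>V\<close> is neither a single vertex nor a
        nonadjacent pair, so the removals below leave a nonempty set.\<close>
      case noniso: False
      then consider v where "v \<in> V" "nbhd V v = V"
        | x y where "x \<in> V" "y \<in> V" "x \<noteq> y" "nbhd V x = V - {y}" "nbhd V y = V - {x}"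
        using asum_structure[OF psubset.prems psubset.hyps False] by blast
      then show ?thesis
      proof cases
        case (1 v)
        have ne: "V - {v} \<noteq> {}" using 1 noniso by (metis Diff_eq_empty_iff insert_absorb subset_singletonD empty_iff)
        have "asum (V - {v})"
          using 1 by (intro asum_joined[OF psubset.prems _ ne]) (auto simp: nbhd_def)
        then show ?thesis
          using IH[of "{v}"] 1 separates_universal[OF psubset.hyps 1 ne] by blast
      next
        case (2 x y)
        have ne: "V - {x, y} \<noteq> {}"
        proof
          assume "V - {x, y} = {}"
          then have "nbhd V x = {x}" using 2 by auto
          with noniso 2 show False by blast
        qed
        have "asum (V - {x, y})"
          using 2 by (intro asum_joined[OF psubset.prems _ ne]) (auto simp: nbhd_def)
        then show ?thesis
          using IH[of "{x, y}"] 2 separates_antipodal[OF psubset.hyps 2 ne] by blast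
      qed
    qed
  qed
qed

end

section \<open>Hypergraphs and the equivalence\<close>

text \<open>Weight is linear in the characteristic vector, so a violation would give two pairs of
  equal total weight, one below \<open>2 * t\<close> and the other not.\<close>

lemma threshold_imp_two_asummable:
  assumes "hypergraph H" "threshold_hypergraph H"
  shows "two_asummable H"
  unfolding two_asummable_def
proof (intro notI, elim exE conjE)
  fix A1 A2 B1 B2
  assume sets: "independent_set H A1" "independent_set H A2" "dependent_set H B1" "dependent_set H B2"
    and eq: "(\<lambda>x. indicator A1 x + indicator A2 x :: nat) = (\<lambda>x. indicator B1 x + indicator B2 x)"
  obtain w :: "'a \<Rightarrow> nat" and t where w: "\<And>X. X \<subseteq> hverts H \<Longrightarrow> t \<le> sum w X \<longleftrightarrow> (\<exists>e\<in>hedges H. e \<subseteq> X)"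
    using assms(2) unfolding threshold_hypergraph_def by blast
  have sum: "sum w X = (\<Sum>x\<in>hverts H. w x * indicator X x)" if "X \<subseteq> hverts H" for X
    using assms(1) that by (intro sum.mono_neutral_cong_left) (auto simp: hypergraph_def)
  have "sum w A1 + sum w A2 = (\<Sum>x\<in>hverts H. w x * (indicator A1 x + indicator A2 x))"
    using sets by (simp add: sum independent_set_def sum.distrib distrib_left)
  also have "\<dots> = (\<Sum>x\<in>hverts H. w x * (indicator B1 x + indicator B2 x))"
    by (intro sum.cong arg_cong[of _ _ "(*) _"] fun_cong[OF eq] HOL.refl)
  also have "\<dots> = sum w B1 + sum w B2"
    using sets by (simp add: sum dependent_set_def sum.distrib distrib_left)
  finally have "sum w A1 + sum w A2 = sum w B1 + sum w B2" .
  moreover have "sum w A1 < t" "sum w A2 < t" "t \<le> sum w B1" "t \<le> sum w B2"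
    using sets w by (auto simp: independent_set_def dependent_set_def simp flip: not_le)
  ultimately show False by linarith
qed

lemma indicator_sum_eq_iff:
  "(\<lambda>x. indicator A1 x + indicator A2 x :: nat) = (\<lambda>x. indicator B1 x + indicator B2 x) \<longleftrightarrow>
    A1 \<inter> A2 = B1 \<inter> B2 \<and> A1 \<union> A2 = B1 \<union> B2"
proof -
  have "(indicator A1 x + indicator A2 x :: nat) = indicator B1 x + indicator B2 x \<longleftrightarrow>
    (x \<in> A1 \<inter> A2 \<longleftrightarrow> x \<in> B1 \<inter> B2) \<and> (x \<in> A1 \<union> A2 \<longleftrightarrow> x \<in> B1 \<union> B2)" for x
    by (auto simp: indicator_def)
  then show ?thesis unfolding fun_eq_iff set_eq_iff by blast
qed

text \<open>Domination passes to supersets within the vertex set, and by finiteness every dominating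
  set contains a minimal one.\<close>

lemma dominating_set_hypergraph_edge_iff:
  assumes "finite (pverts G)" "X \<subseteq> pverts G"
  shows "(\<exists>e\<in>hedges (dominating_set_hypergraph G). e \<subseteq> X) \<longleftrightarrow> dominating_set G X"
proof
  assume "\<exists>e\<in>hedges (dominating_set_hypergraph G). e \<subseteq> X"
  then obtain e where "e \<subseteq> X" "dominating_set G e"
    by (auto simp: dominating_set_hypergraph_def)
  then show "dominating_set G X"
    using assms(2) unfolding dominating_set_def by blast
next
  assume X: "dominating_set G X"
  let ?F = "{D. D \<subseteq> X \<and> dominating_set G D}"
  have "finite ?F" using finite_subset[OF assms(2,1)] by simp
  moreover have "?F \<noteq> {}" using X by blast
  ultimately obtain m where m: "m \<in> ?F" and min: "\<forall>D\<in>?F. D \<subseteq> m \<longrightarrow> m = D"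
    using finite_has_minimal[of ?F] by blast
  then have "m \<in> hedges (dominating_set_hypergraph G)"
    unfolding dominating_set_hypergraph_def by auto
  with m show "\<exists>e\<in>hedges (dominating_set_hypergraph G). e \<subseteq> X" by blast
qed

theorem theorem3p7:
  fixes G :: "'a pair_pre_digraph"
  assumes "pair_graph G"
  shows "(domishold G \<longleftrightarrow> threshold_hypergraph (dominating_set_hypergraph G)) \<and>
         (threshold_hypergraph (dominating_set_hypergraph G) \<longleftrightarrow>
          two_asummable (dominating_set_hypergraph G))"
proof -
  interpret pair_graph G by fact
  let ?H = "dominating_set_hypergraph G"
  define r where "r = (\<lambda>u v. u = v \<or> (u, v) \<in> parcs G)"
  have "(v, u) \<in> parcs G" if "(u, v) \<in> parcs G" for u v
    using arcs_symmetric that by blast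
  then interpret r: tolerance r by unfold_locales (auto simp: r_def)
  have verts: "hverts ?H = pverts G" by (simp add: dominating_set_hypergraph_def)
  note edge_iff = dominating_set_hypergraph_edge_iff[OF pair_finite_verts]
  have dom: "dominating_set G = r.dom (pverts G)"
    unfolding fun_eq_iff dominating_set_def r.dom_def by (auto simp: r_def)
  \<comment> \<open>By \<open>edge_iff\<close>, the same weights and threshold serve both
    sides.\<close>
  have eq: "domishold G \<longleftrightarrow> threshold_hypergraph ?H"
    unfolding domishold_def threshold_hypergraph_def verts using edge_iff by simp
  have indep: "independent_set ?H A \<longleftrightarrow> A \<subseteq> pverts G \<and> \<not> dominating_set G A" for A
    unfolding independent_set_def verts using edge_iff by blast
  have dep: "dependent_set ?H B \<longleftrightarrow> dominating_set G B" for B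
  proof -
    have "dominating_set G B \<Longrightarrow> B \<subseteq> pverts G" by (simp add: dominating_set_def)
    then show ?thesis unfolding dependent_set_def verts using edge_iff by blast
  qed
  have "domishold G" if "two_asummable ?H"
  proof -
    have "r.asum (pverts G)"
      using that unfolding two_asummable_def r.asum_def indep dep indicator_sum_eq_iff dom by blast
    then obtain w t where "r.separates w t (pverts G)"
      using r.asum_separates[OF pair_finite_verts] by blast
    then show ?thesis unfolding domishold_def r.separates_def dom by blast
  qed
  moreover have "two_asummable ?H" if "threshold_hypergraph ?H"
    using threshold_imp_two_asummable[OF hypergraph_dominating_set_hypergraph] assms that by blast
  ultimately show ?thesis using eq by blast
qed

end
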